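(* The logic $\mathrm{TeamLTL}^l$ (LTL formulae in negation normal form evaluated under the lax team semantics $\models^l$) satisfies downward closure, the empty team property, singleton equivalence and flatness; that is, for every such formula $\varphi$, every team $T$ and every trace $t$: (1) if $T\models^l\varphi$ and $S\subseteq T$ then $S\models^l\varphi$; (2) $\emptyset\models^l\varphi$; (3) $\{t\}\models^l\varphi$ iff $t\models\varphi$; (4) $T\models^l\varphi$ iff $\{s\}\models^l\varphi$ for all $s\in T$.
   Context: A trace over a set $\mathrm{AP}$ of atomic propositions is an infinite sequence $t\in(2^{\mathrm{AP}})^\omega$; $t[i,\infty]$ is its suffix from position $i$. A team is a set of traces. LTL formulae (in negation normal form) are built by $\varphi::=p\mid\neg p\mid\varphi\lor\varphi\mid\varphi\land\varphi\mid \mathsf{X}\varphi\mid\mathsf{G}\varphi\mid\varphi\,\mathsf{U}\,\varphi$ ($p\in\mathrm{AP}$), with the usual semantics $t\models\varphi$ on single traces. Lax team semantics: write $\mathcal P(\mathbb N)^+$ for the nonempty subsets of $\mathbb N$; for $f:T\to\mathcal P(\mathbb N)^+$ put $T[f,\infty]=\{t[s,\infty]\mid t\in T, s\in f(t)\}$, and $T[1,\infty]=\{t[1,\infty]\mid t\in T\}$. For $T'\subseteq T$, $f:T\to\mathcal P(\mathbb N)^+$, $f':T'\to\mathcal P(\mathbb N)^+$, write $f'<f$ iff for all $t\in T'$: $\min f'(t)\le\min f(t)$ and $\max f'(t)<\max f(t)$ (the latter required only when $\max f(t)$ exists). Then: $T\models^l l$ (literal $l$) iff $t\models l$ for all $t\in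 T$; $T\models^l\varphi\land\psi$ iff both hold; $T\models^l\varphi\lor\psi$ iff there are $T_1\cup T_2=T$ with $T_1\models^l\varphi$, $T_2\models^l\psi$; $T\models^l\mathsf X\varphi$ iff $T[1,\infty]\models^l\varphi$; $T\models^l\mathsf G\varphi$ iff $T[f,\infty]\models^l\varphi$ for all $f:T\to\mathcal P(\mathbb N)^+$; $T\models^l\varphi\,\mathsf U\,\psi$ iff there is $f:T\to\mathcal P(\mathbb N)^+$ with $T[f,\infty]\models^l\psi$ and, for $T'=\{t\in T\mid f(t)\neq\{0\}\}$, for every $f':T'\to\mathcal P(\mathbb N)^+$ with $f'<f$ we have $T'[f',\infty]\models^l\varphi$ or $T'=\emptyset$. *)

theory Defs
  imports Main "HOL-Library.FuncSet" "HOL-Library.Omega_Words_Fun"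
begin

type_synonym 'ap trace = "'ap set word"

type_synonym 'ap team = "'ap trace set"

datatype 'ap ltl =
    Prop 'ap
  | NProp 'ap
  | Or "'ap ltl" "'ap ltl"
  | And "'ap ltl" "'ap ltl"
  | Next "'ap ltl"
  | Globally "'ap ltl"
  | Until "'ap ltl" "'ap ltl"

primrec ltl_sat :: "'ap trace \<Rightarrow> 'ap ltl \<Rightarrow> bool" (infix \<open>\<Turnstile>\<close> 50) where
  "t \<Turnstile> Prop p \<longleftrightarrow> p \<in> t 0"
| "t \<Turnstile> NProp p \<longleftrightarrow> p \<notin> t 0"
| "t \<Turnstile> Or \<phi> \<psi> \<longleftrightarrow> t \<Turnstile> \<phi> \<or> t \<Turnstile> \<psi>"
| "t \<Turnstile> And \<phi> \<psi> \<longleftrightarrow> t \<Turnstile> \<phi> \<and> t \<Turnstile> \<psi>"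
| "t \<Turnstile> Next \<phi> \<longleftrightarrow> suffix 1 t \<Turnstile> \<phi>"
| "t \<Turnstile> Globally \<phi> \<longleftrightarrow> (\<forall>i. suffix i t \<Turnstile> \<phi>)"
| "t \<Turnstile> Until \<phi> \<psi> \<longleftrightarrow> (\<exists>i. suffix i t \<Turnstile> \<psi> \<and> (\<forall>j<i. suffix j t \<Turnstile> \<phi>))"

definition nonempty_times :: "nat set set" where
  "nonempty_times = {A. A \<noteq> {}}"

definition team_suffix :: "'ap team \<Rightarrow> ('ap trace \<Rightarrow> nat set) \<Rightarrow> 'ap team" where
  "team_suffix T f = {suffix s t | s t. t \<in> T \<and> s \<in> f t}"

definition team_next :: "'ap team \<Rightarrow> 'ap team" where
  "team_next T = {suffix 1 t | t. t \<in> T}"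

text \<open>
  The relation $f' < f$ on the domain $T'$ of $f'$. On nonempty sets of naturals, \<^const>\<open>Inf\<close> is
  the minimum, also for infinite sets, and the maximum exists iff the set is finite. If $f(t)$
  has a maximum, then $\max f'(t) < \max f(t)$ includes that $f'(t)$ has one, too.
\<close>

definition earlier :: "'ap team \<Rightarrow> ('ap trace \<Rightarrow> nat set) \<Rightarrow> ('ap trace \<Rightarrow> nat set) \<Rightarrow> bool" where
  "earlier T' f' f \<longleftrightarrow>
     (\<forall>t\<in>T'. Inf (f' t) \<le> Inf (f t) \<and>
       (finite (f t) \<longrightarrow> finite (f' t) \<and> Max (f' t) < Max (f t)))"

text \<open>
  Maps $T \to \mathcal{P}(\mathbb{N})^+$ are total functions constrained on $T$ only; their values
  outside $T$ are irrelevant.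
\<close>

primrec team_sat :: "'ap team \<Rightarrow> 'ap ltl \<Rightarrow> bool" (infix \<open>\<Turnstile>\<^sup>l\<close> 50) where
  "T \<Turnstile>\<^sup>l Prop p \<longleftrightarrow> (\<forall>t\<in>T. t \<Turnstile> Prop p)"
| "T \<Turnstile>\<^sup>l NProp p \<longleftrightarrow> (\<forall>t\<in>T. t \<Turnstile> NProp p)"
| "T \<Turnstile>\<^sup>l Or \<phi> \<psi> \<longleftrightarrow> (\<exists>T1 T2. T1 \<union> T2 = T \<and> T1 \<Turnstile>\<^sup>l \<phi> \<and> T2 \<Turnstile>\<^sup>l \<psi>)"
| "T \<Turnstile>\<^sup>l And \<phi> \<psi> \<longleftrightarrow> T \<Turnstile>\<^sup>l \<phi> \<and> T \<Turnstile>\<^sup>l \<psi>"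
| "T \<Turnstile>\<^sup>l Next \<phi> \<longleftrightarrow> team_next T \<Turnstile>\<^sup>l \<phi>"
| "T \<Turnstile>\<^sup>l Globally \<phi> \<longleftrightarrow> (\<forall>f \<in> T \<rightarrow> nonempty_times. team_suffix T f \<Turnstile>\<^sup>l \<phi>)"
| "T \<Turnstile>\<^sup>l Until \<phi> \<psi> \<longleftrightarrow>
     (\<exists>f \<in> T \<rightarrow> nonempty_times.
        team_suffix T f \<Turnstile>\<^sup>l \<psi> \<and>
        (let T' = {t \<in> T. f t \<noteq> {0}} in
           \<forall>f' \<in> T' \<rightarrow> nonempty_times.
             earlier T' f' f \<longrightarrow> team_suffix T' f' \<Turnstile>\<^sup>l \<phi> \<or> T' = {}))"

end

theory Submission
  imports Defs
begin

text \<open>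
  All four properties follow from one equivalence, proved by induction on the formula: a team
  satisfies a formula iff each of its traces does. For \<^const>\<open>Until\<close>, the minimum of $f(t)$ is a
  witness for the trace $t$: every time $j$ before it is reached by an earlier $f'$ with
  $f'(t) = \{j\}$ and $f'(s) = \{0\}$ for $s \neq t$. Conversely,
  any choice of witnesses for the traces gives a singleton-valued $f$.
\<close>

lemma ball_team_suffix_iff: "(\<forall>u\<in>team_suffix T f. P u) \<longleftrightarrow> (\<forall>t\<in>T. \<forall>s\<in>f t. P (suffix s t))"
  by (auto simp: team_suffix_def)

lemma ball_team_next_iff: "(\<forall>u\<in>team_next T. P u) \<longleftrightarrow> (\<forall>t\<in>T. P (suffix 1 t))"
  by (auto simp: team_next_def)

text \<open>This makes \<open>{0}\<close> an admissible default value of an earlier map: wherever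
  $f(s)$ differs from \<open>{0}\<close> and has a maximum, that maximum is strictly above 0, as
  \<open>earlier\<close> demands.\<close>

lemma Max_pos_nat:
  fixes A :: "nat set"
  assumes "finite A" "A \<noteq> {}" "A \<noteq> {0}"
  shows "0 < Max A"
proof -
  obtain a where "a \<in> A" "0 < a"
    using assms by (metis all_not_in_conv gr0I is_singletonI' is_singleton_the_elem singleton_iff)
  then show ?thesis
    using assms(1) Max_ge by (meson less_le_trans)
qed

lemma team_sat_iff_ball: "T \<Turnstile>\<^sup>l \<phi> \<longleftrightarrow> (\<forall>t\<in>T. t \<Turnstile> \<phi>)"
proof (induction \<phi> arbitrary: T)
  case (Or \<phi> \<psi>)
  have "\<exists>T1 T2. T1 \<union> T2 = T \<and> (\<forall>t\<in>T1. t \<Turnstile> \<phi>) \<and> (\<forall>t\<in>T2. t \<Turnstile> \<psi>)"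
    if "\<forall>t\<in>T. t \<Turnstile> \<phi> \<or> t \<Turnstile> \<psi>"
    using that by (intro exI[of _ "{t\<in>T. t \<Turnstile> \<phi>}"] exI[of _ "{t\<in>T. t \<Turnstile> \<psi>}"]) auto
  then show ?case
    by (auto simp: Or)
next
  case (Next \<phi>)
  then show ?case
    by (simp add: ball_team_next_iff)
next
  case (Globally \<phi>)
  \<comment> \<open>A single position of a single trace is reached by the map with constant value
    \<open>{i}\<close>.\<close>
  have "suffix i t \<Turnstile> \<phi>"
    if "\<forall>f\<in>T \<rightarrow> nonempty_times. \<forall>t\<in>T. \<forall>s\<in>f t. suffix s t \<Turnstile> \<phi>" "t \<in> T" for i t
    using bspec[OF that(1), of "\<lambda>_. {i}"] that(2) by (auto simp: nonempty_times_def)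
  then show ?case
    by (auto simp: Globally ball_team_suffix_iff)
next
  case (Until \<phi> \<psi>)
  show ?case
  proof
    assume "T \<Turnstile>\<^sup>l Until \<phi> \<psi>"
    then obtain f where f: "f \<in> T \<rightarrow> nonempty_times"
      and "team_suffix T f \<Turnstile>\<^sup>l \<psi>"
      and *: "\<forall>f' \<in> {t \<in> T. f t \<noteq> {0}} \<rightarrow> nonempty_times.
        earlier {t \<in> T. f t \<noteq> {0}} f' f \<longrightarrow>
        team_suffix {t \<in> T. f t \<noteq> {0}} f' \<Turnstile>\<^sup>l \<phi> \<or> {t \<in> T. f t \<noteq> {0}} = {}"
      unfolding team_sat.simps Let_def by (elim bexE conjE)
    then have \<psi>: "\<And>t s. t \<in> T \<Longrightarrow> s \<in> f t \<Longrightarrow> suffix s t \<Turnstile> \<psi>"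
      unfolding Until ball_team_suffix_iff by blast
    \<comment> \<open>The alternative that $T'$ is empty is ruled out by the trace \<open>t\<close>,
      which lies in $T'$.\<close>
    have \<phi>: "suffix s t \<Turnstile> \<phi>"
      if "f' \<in> {t \<in> T. f t \<noteq> {0}} \<rightarrow> nonempty_times"
        "earlier {t \<in> T. f t \<noteq> {0}} f' f" "t \<in> T" "f t \<noteq> {0}" "s \<in> f' t" for f' t s
    proof -
      have "team_suffix {t \<in> T. f t \<noteq> {0}} f' \<Turnstile>\<^sup>l \<phi>"
        using bspec[OF * that(1)] that(2-4) by blast
      then show ?thesis
        using that(3-5) unfolding Until ball_team_suffix_iff by blast
    qed
    show "\<forall>t\<in>T. t \<Turnstile> Until \<phi> \<psi>"
    proof
      fix t assume t: "t \<in> T"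
      have ne: "f s \<noteq> {}" if "s \<in> T" for s
        using f that by (auto simp: nonempty_times_def)
      have "suffix j t \<Turnstile> \<phi>" if j: "j < Inf (f t)" for j
      proof -
        define f' where "f' = (\<lambda>s. if s = t then {j} else {0})"
        \<comment> \<open>If $f(t)$ is finite, being below its minimum puts \<open>j\<close>
          strictly below its maximum; if it is infinite, \<open>earlier\<close> only compares
          minima.\<close>
        have "Inf (f t) \<le> Max (f t)" if "finite (f t)"
          using that ne[OF t] by (simp add: cInf_eq_Min)
        then have "finite (f t) \<Longrightarrow> j < Max (f t)"
          using j by (meson less_le_trans)
        moreover have "0 < Max (f s)" if "s \<in> T" "f s \<noteq> {0}" "finite (f s)" for s
          using that ne by (blast intro: Max_pos_nat)
        ultimately have "earlier {t \<in> T. f t \<noteq> {0}} f' f"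
          using j unfolding earlier_def f'_def by (simp del: neq0_conv)
        \<comment> \<open>Since \<open>j\<close> lies below the minimum of $f(t)$, this minimum is
          not 0, so \<open>t\<close> belongs to $T'$ and the condition on \<open>f'\<close> says
          something about it.\<close>
        moreover have "f t \<noteq> {0}"
          using j by (metis cInf_singleton not_less0)
        ultimately show ?thesis
          using \<phi>[of f' t j] t by (auto simp: f'_def nonempty_times_def)
      qed
      \<comment> \<open>The minimum is attained because $f(t)$ is nonempty.\<close>
      moreover have "suffix (Inf (f t)) t \<Turnstile> \<psi>"
        using \<psi> t ne by (simp add: Inf_nat_def1)
      ultimately show "t \<Turnstile> Until \<phi> \<psi>"
        by auto
    qed
  next
    assume "\<forall>t\<in>T. t \<Turnstile> Until \<phi> \<psi>"
    then obtain i where i: "\<And>t. t \<in> T \<Longrightarrow> suffix (i t) t \<Turnstile> \<psi>"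
        "\<And>t j. t \<in> T \<Longrightarrow> j < i t \<Longrightarrow> suffix j t \<Turnstile> \<phi>"
      by simp metis
    define f where "f = (\<lambda>t. {i t})"
    have f: "f \<in> T \<rightarrow> nonempty_times"
      by (simp add: f_def nonempty_times_def)
    \<comment> \<open>As $f(t)$ is the finite set \<open>{i t}\<close>, the condition on maxima
      applies and forces all of \<open>f' t\<close> strictly below \<open>i t\<close>, where the
      witness property gives \<open>\<phi>\<close>.\<close>
    have "suffix s t \<Turnstile> \<phi>"
      if "earlier T' f' f" "T' \<subseteq> T" "t \<in> T'" "s \<in> f' t" for T' f' t s
    proof -
      have "finite (f' t)" "Max (f' t) < i t"
        using that(1,3) by (simp_all add: earlier_def f_def)
      then have "s < i t"
        using Max_ge that(4) by (meson le_less_trans)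
      then show ?thesis
        using i(2) that(2,3) by blast
    qed
    then have "team_suffix T' f' \<Turnstile>\<^sup>l \<phi>" if "earlier T' f' f" "T' \<subseteq> T" for T' f'
      using that unfolding Until ball_team_suffix_iff by blast
    moreover have "team_suffix T f \<Turnstile>\<^sup>l \<psi>"
      using i(1) by (simp add: Until ball_team_suffix_iff f_def)
    ultimately show "T \<Turnstile>\<^sup>l Until \<phi> \<psi>"
      using f unfolding team_sat.simps Let_def by blast
  qed
qed auto

theorem theorem5:
  shows "(\<forall>(\<phi> :: 'ap ltl) T S. T \<Turnstile>\<^sup>l \<phi> \<and> S \<subseteq> T \<longrightarrow> S \<Turnstile>\<^sup>l \<phi>) \<and>
         (\<forall>\<phi> :: 'ap ltl. {} \<Turnstile>\<^sup>l \<phi>) \<and>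
         (\<forall>(\<phi> :: 'ap ltl) t. {t} \<Turnstile>\<^sup>l \<phi> \<longleftrightarrow> t \<Turnstile> \<phi>) \<and>
         (\<forall>(\<phi> :: 'ap ltl) T. T \<Turnstile>\<^sup>l \<phi> \<longleftrightarrow> (\<forall>s\<in>T. {s} \<Turnstile>\<^sup>l \<phi>))"
  by (auto simp: team_sat_iff_ball)

end
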